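(* Suppose $c \geq 3$ and there exists a node $i_0 \in \mathcal{I}$ such that the distance vector $D_{\mathcal{F};i_0}$ is not constant, i.e. $D_{\mathcal{F};i_0} \notin \mathbb{R}\mathbf{1}_c$. Then there exists no (smooth) potential $J \colon \mathcal{W} \to \mathbb{R}$ satisfying $$R_W S(W) = -\operatorname{grad} J(W)\qquad\text{for all } W\in\mathcal{W},$$ i.e. the assignment flow $\dot W = R_W S(W)$ is not a Riemannian gradient descent flow.
   Context: Notation: $n,c\in\mathbb{N}$, $\mathcal{I}=\{1,\dots,n\}$, $\mathbf{1}_c=(1,\dots,1)^\top\in\mathbb{R}^c$. Products, quotients, exponentials and logarithms of vectors are componentwise, $\langle\cdot,\cdot\rangle$ is the Euclidean inner product. Manifold: $\mathcal{S}=\{p\in\mathbb{R}^c : p_j>0\ \forall j,\ \langle \mathbf{1}_c,p\rangle=1\}$ with tangent space $T_0=\{v\in\mathbb{R}^c:\langle\mathbf{1}_c,v\rangle=0\}$ and Fisher–Rao metric $g_p(u,v)=\sum_{j=1}^c u_jv_j/p_j$ for $u,v\in T_0$. The assignment manifold is the product $\mathcal{W}=\mathcal{S}\times\dots\times\mathcal{S}$ ($n$ factors) with the product metric, identified with the matrices $W\in\mathbb{R}^{n\times c}$ with positive entries and rows $W_i\in\mathcal{S}$; its tangent space is $\mathcal{T}_0=\{V\in\mathbb{R}^{n\times c}: V\mathbf{1}_c=0\}$. $\operatorname{grad}J(W)\in\mathcal{T}_0$ is the Riemannian gradient with respect to this metric. For $p\in\mathcal{S}$, $R_p=\operatorname{Diag}(p)-pp^\top:\mathbb{R}^c\to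 T_0$, and $R_W$ applies $R_{W_i}$ to the $i$-th row, for each $i\in\mathcal{I}$. Maps: for $p,q\in\mathcal{S}$, $v\in T_0$: $\operatorname{Exp}_p(v)=\frac{p e^{v/p}}{\langle p,e^{v/p}\rangle}$, $\operatorname{Exp}_p^{-1}(q)=R_p\log\frac{q}{p}$, and $\exp_p=\operatorname{Exp}_p\circ R_p$ (also applied to arguments in $\mathbb{R}^c$). Data: $(\mathcal{F},d_{\mathcal{F}})$ is a metric space, $f_1,\dots,f_n\in\mathcal{F}$ are data, $f_1^*,\dots,f_c^*\in\mathcal{F}$ are prototypes, and the distance vectors are $D_{\mathcal{F};i}=(d_{\mathcal{F}}(f_i,f_1^* ),\dots,d_{\mathcal{F}}(f_i,f_c^* ))^\top\in\mathbb{R}^c$, $i\in\mathcal{I}$. $\rho>0$ is a fixed scaling parameter. Graph and weights: $\mathcal{G}=(\mathcal{I},\mathcal{E})$ is an undirected graph, $\mathcal{N}_i=\{k\in\mathcal{I}: ik\in\mathcal{E}\}\cup\{i\}$ (so $k\in\mathcal{N}_i\Leftrightarrow i\in\mathcal{N}_k$). Weights satisfy $\omega_{ik}>0$ for $k\in\mathcal{N}_i$ and $\sum_{k\in\mathcal{N}_i}\omega_{ik}=1$ for every $i\in\mathcal{I}$. Likelihood map: $L_i(W_i)=\exp_{W_i}(-\frac1\rho D_{\mathcal{F};i})=\frac{W_ie^{-D_{\mathcal{F};i}/\rho}}{\langle W_i,e^{-D_{\mathcal{F};i}/\rho}\rangle}$. Similarity map $S:\mathcal{W}\to\mathcal{W}$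 with rows $S_i(W)=\operatorname{Exp}_{W_i}\big(\sum_{k\in\mathcal{N}_i}\omega_{ik}\operatorname{Exp}_{W_i}^{-1}(L_k(W_k))\big)$, $i\in\mathcal{I}$. *)

theory Defs
  imports "HOL-Analysis.Analysis"
begin

text \<open>
  The nodes \<open>1,\<dots>,n\<close> are the elements of a finite type \<open>'n\<close>, the labels \<open>1,\<dots>,c\<close> those of a
  finite type \<open>'c\<close>; \<open>1 :: real ^ 'c\<close> is the all-ones vector.  A matrix
  \<open>W :: real ^ 'c ^ 'n\<close> has the rows \<open>W $ i :: real ^ 'c\<close>.
\<close>

definition simplex_mfd :: "(real ^ 'c) set" where
  "simplex_mfd = {p. (\<forall>j. p $ j > 0) \<and> 1 \<bullet> p = 1}"

definition simplex_tangent :: "(real ^ 'c) set" where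
  "simplex_tangent = {v. 1 \<bullet> v = 0}"

definition fisher_rao :: "real ^ 'c \<Rightarrow> real ^ 'c \<Rightarrow> real ^ 'c \<Rightarrow> real" where
  "fisher_rao p u v = (\<Sum>j\<in>UNIV. u $ j * v $ j / p $ j)"

definition assignment_mfd :: "(real ^ 'c ^ 'n) set" where
  "assignment_mfd = {W. \<forall>i. W $ i \<in> simplex_mfd}"

definition assignment_tangent :: "(real ^ 'c ^ 'n) set" where
  "assignment_tangent = {V. \<forall>i. V $ i \<in> simplex_tangent}"

definition assignment_metric ::
    "real ^ 'c ^ 'n \<Rightarrow> real ^ 'c ^ 'n \<Rightarrow> real ^ 'c ^ 'n \<Rightarrow> real" where
  "assignment_metric W U V = (\<Sum>i\<in>UNIV. fisher_rao (W $ i) (U $ i) (V $ i))"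

text \<open>
  Functions on the assignment manifold are total functions on the ambient matrix space; only
  their values on the manifold matter, since all derivatives are taken within the manifold.
  The manifold is relatively open in an affine subspace with direction \<open>assignment_tangent\<close>, so
  such a derivative is determined exactly on tangent directions, and \<open>C\<^sup>k\<close> regularity
  amounts to the following recursion over tangential derivatives.
\<close>

primrec assignment_Ck :: "nat \<Rightarrow> (real ^ 'c ^ 'n \<Rightarrow> real) \<Rightarrow> bool" where
  "assignment_Ck 0 J \<longleftrightarrow> continuous_on assignment_mfd J"
| "assignment_Ck (Suc k) J \<longleftrightarrow>
     (\<exists>J'. (\<forall>W\<in>assignment_mfd. (J has_derivative J' W) (at W within assignment_mfd)) \<and>
           (\<forall>V\<in>assignment_tangent. assignment_Ck k (\<lambda>W. J' W V)))"

definition assignment_smooth :: "(real ^ 'c ^ 'n \<Rightarrow> real) \<Rightarrow> bool" where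
  "assignment_smooth J \<longleftrightarrow> (\<forall>k. assignment_Ck k J)"

definition has_riemannian_grad ::
    "(real ^ 'c ^ 'n \<Rightarrow> real) \<Rightarrow> real ^ 'c ^ 'n \<Rightarrow> real ^ 'c ^ 'n \<Rightarrow> bool" where
  "has_riemannian_grad J G W \<longleftrightarrow> G \<in> assignment_tangent \<and>
     (\<exists>J'. (J has_derivative J') (at W within assignment_mfd) \<and>
           (\<forall>V\<in>assignment_tangent. assignment_metric W G V = J' V))"

text \<open>
  At points of the manifold where \<open>J\<close> is differentiable there is exactly one such \<open>G\<close>, so that
  the description below is proper for smooth \<open>J\<close>.
\<close>

definition riemannian_grad ::
    "(real ^ 'c ^ 'n \<Rightarrow> real) \<Rightarrow> real ^ 'c ^ 'n \<Rightarrow> real ^ 'c ^ 'n" where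
  "riemannian_grad J W = (THE G. has_riemannian_grad J G W)"

definition replicator :: "real ^ 'c \<Rightarrow> real ^ 'c ^ 'c" where
  "replicator p = (\<chi> j k. (if j = k then p $ j else 0) - p $ j * p $ k)"

definition replicator_rows :: "real ^ 'c ^ 'n \<Rightarrow> real ^ 'c ^ 'n \<Rightarrow> real ^ 'c ^ 'n" where
  "replicator_rows W V = (\<chi> i. replicator (W $ i) *v (V $ i))"

text \<open>
  \<open>Exp_map\<close> and \<open>Exp_inv\<close> are the maps \<open>Exp\<^sub>p\<close> and \<open>Exp\<^sub>p\<^sup>-\<^sup>1\<close>, and
  \<open>lift_map\<close> is the lower-case \<open>exp\<^sub>p = Exp\<^sub>p \<circ> R\<^sub>p\<close>.
\<close>

definition Exp_map :: "real ^ 'c \<Rightarrow> real ^ 'c \<Rightarrow> real ^ 'c" where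
  "Exp_map p v =
     (\<chi> j. p $ j * exp (v $ j / p $ j) / (p \<bullet> (\<chi> k. exp (v $ k / p $ k))))"

definition Exp_inv :: "real ^ 'c \<Rightarrow> real ^ 'c \<Rightarrow> real ^ 'c" where
  "Exp_inv p q = replicator p *v (\<chi> j. ln (q $ j / p $ j))"

definition lift_map :: "real ^ 'c \<Rightarrow> real ^ 'c \<Rightarrow> real ^ 'c" where
  "lift_map p v = Exp_map p (replicator p *v v)"

definition distance_vec :: "('n \<Rightarrow> 'f::metric_space) \<Rightarrow> ('c \<Rightarrow> 'f) \<Rightarrow> 'n \<Rightarrow> real ^ 'c" where
  "distance_vec f fstar i = (\<chi> j. dist (f i) (fstar j))"

definition neighborhood :: "('n \<times> 'n) set \<Rightarrow> 'n \<Rightarrow> 'n set" where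
  "neighborhood E i = {k. (i, k) \<in> E} \<union> {i}"

definition likelihood :: "real \<Rightarrow> ('n \<Rightarrow> real ^ 'c) \<Rightarrow> 'n \<Rightarrow> real ^ 'c \<Rightarrow> real ^ 'c" where
  "likelihood \<rho> D i p = lift_map p (- (1 / \<rho>) *\<^sub>R D i)"

definition similarity ::
    "('n \<times> 'n) set \<Rightarrow> ('n \<Rightarrow> 'n \<Rightarrow> real) \<Rightarrow> real \<Rightarrow> ('n \<Rightarrow> real ^ 'c) \<Rightarrow>
      real ^ 'c ^ 'n \<Rightarrow> real ^ 'c ^ 'n" where
  "similarity E \<omega> \<rho> D W =
     (\<chi> i. Exp_map (W $ i)
        (\<Sum>k\<in>neighborhood E i. \<omega> i k *\<^sub>R Exp_inv (W $ i) (likelihood \<rho> D k (W $ k))))"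

end

theory Submission
  imports Defs
begin

text \<open>
  If \<open>R\<^sub>W S(W) = - grad J(W)\<close>, then \<open>dJ(W) V = - \<langle>S(W), V\<rangle>\<close> for tangent \<open>V\<close>, since \<open>R\<^sub>W\<close> turns the
  Euclidean inner product into the metric.  The logarithms of \<open>W\<^sub>i\<close> cancel in \<open>S\<^sub>i\<close>, so that
  \<open>S\<^sub>i\<close> is proportional to \<open>b W\<^sub>i\<^sup>w\<close> with \<open>w = \<omega>\<^sub>i\<^sub>i\<close> and \<open>b\<close> depending only on the other rows.
  Symmetry of the second derivative of \<open>J\<close> in two directions \<open>u, v\<close> of row \<open>i\<close> then reads
  \<open>\<langle>S\<^sub>i, u\<rangle> \<langle>S\<^sub>i / W\<^sub>i, v\<rangle> = \<langle>S\<^sub>i, v\<rangle> \<langle>S\<^sub>i / W\<^sub>i, u\<rangle>\<close>.  For \<open>u = e\<^sub>1 - e\<^sub>2\<close>, \<open>v = e\<^sub>1 - e\<^sub>3\<close> this fails as soon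
  as row \<open>i\<close> has equal entries at labels 1, 2, a different one at label 3, and the values of \<open>b\<close> at
  labels 1 and 2 differ.  The latter can be arranged: either \<open>i\<close> has a neighbour, whose row can be
  chosen freely, or \<open>b = exp (- D\<^sub>i / \<rho>)\<close>, which is not constant.
\<close>

section \<open>Symmetry of mixed partial derivatives\<close>

text \<open>The mean value theorem is applied twice: to \<open>\<lambda>s. h s r - h s 0\<close>,
  then to \<open>A a\<close>.\<close>

lemma second_difference_mean_value:
  fixes h A A' :: "real \<Rightarrow> real \<Rightarrow> real"
  assumes r: "0 < r"
    and h: "\<And>s t. 0 \<le> s \<Longrightarrow> s \<le> r \<Longrightarrow> 0 \<le> t \<Longrightarrow> t \<le> r \<Longrightarrow>
      ((\<lambda>s. h s t) has_real_derivative A s t) (at s)"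
    and A: "\<And>s t. 0 \<le> s \<Longrightarrow> s \<le> r \<Longrightarrow> 0 \<le> t \<Longrightarrow> t \<le> r \<Longrightarrow>
      (A s has_real_derivative A' s t) (at t)"
  obtains a b where "0 < a" "a < r" "0 < b" "b < r"
    "h r r - h r 0 - h 0 r + h 0 0 = r\<^sup>2 * A' a b"
proof -
  have "\<exists>a. 0 < a \<and> a < r \<and> (h r r - h r 0) - (h 0 r - h 0 0) = (r - 0) * (A a r - A a 0)"
    using r by (intro MVT2) (auto intro!: DERIV_diff h)
  then obtain a where a: "0 < a" "a < r"
    "(h r r - h r 0) - (h 0 r - h 0 0) = r * (A a r - A a 0)" by auto
  have "\<exists>b. 0 < b \<and> b < r \<and> A a r - A a 0 = (r - 0) * A' a b"
    using r a by (intro MVT2) (auto intro!: A)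
  then obtain b where "0 < b" "b < r" "A a r - A a 0 = r * A' a b" by auto
  with a show thesis
    by (intro that[of a b]) (auto simp: power2_eq_square algebra_simps)
qed

text \<open>Schwarz's theorem: the second difference over a square does not depend on the order of
  differencing, so \<open>A'\<close> and \<open>B'\<close> share a value at two points of the
  square, and these tend to the origin as the square shrinks.\<close>

lemma mixed_partials_eq:
  fixes h A B A' B' :: "real \<Rightarrow> real \<Rightarrow> real"
  assumes \<epsilon>: "0 < \<epsilon>"
    and hA: "\<And>s t. \<bar>s\<bar> < \<epsilon> \<Longrightarrow> \<bar>t\<bar> < \<epsilon> \<Longrightarrow> ((\<lambda>s. h s t) has_real_derivative A s t) (at s)"
    and hB: "\<And>s t. \<bar>s\<bar> < \<epsilon> \<Longrightarrow> \<bar>t\<bar> < \<epsilon> \<Longrightarrow> (h s has_real_derivative B s t) (at t)"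
    and A: "\<And>s t. \<bar>s\<bar> < \<epsilon> \<Longrightarrow> \<bar>t\<bar> < \<epsilon> \<Longrightarrow> (A s has_real_derivative A' s t) (at t)"
    and B: "\<And>s t. \<bar>s\<bar> < \<epsilon> \<Longrightarrow> \<bar>t\<bar> < \<epsilon> \<Longrightarrow> ((\<lambda>s. B s t) has_real_derivative B' s t) (at s)"
    and A': "isCont (\<lambda>(s, t). A' s t) (0, 0)"
    and B': "isCont (\<lambda>(s, t). B' s t) (0, 0)"
  shows "A' 0 0 = B' 0 0"
proof -
  \<comment> \<open>The shift by 2 keeps \<open>r n\<close> strictly below \<epsilon> already at
    \<open>n = 0\<close>.\<close>
  define r where "r n = \<epsilon> / real (n + 2)" for n
  have r: "0 < r n" "r n < \<epsilon>" for n
    using \<epsilon> by (auto simp: r_def divide_simps mult_less_cancel_left1)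
  have r0: "r \<longlonglongrightarrow> 0"
    unfolding r_def using LIMSEQ_ignore_initial_segment[OF lim_const_over_n, of \<epsilon> 2] by simp
  let ?\<Delta> = "\<lambda>n. h (r n) (r n) - h (r n) 0 - h 0 (r n) + h 0 0"
  have "\<exists>a b. 0 < a \<and> a < r n \<and> 0 < b \<and> b < r n \<and> ?\<Delta> n = (r n)\<^sup>2 * A' a b" for n
    by (rule second_difference_mean_value[of "r n" h A A'])
      (use r[of n] in \<open>auto intro!: hA A\<close>)
  then obtain a b where a: "\<And>n. 0 < a n" "\<And>n. a n < r n" and b: "\<And>n. 0 < b n" "\<And>n. b n < r n"
    and ab: "\<And>n. ?\<Delta> n = (r n)\<^sup>2 * A' (a n) (b n)" by metis
  \<comment> \<open>The transposed function has the same second difference, with the two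
    differentiations interchanged.\<close>
  have "\<exists>c d. 0 < c \<and> c < r n \<and> 0 < d \<and> d < r n \<and>
      h (r n) (r n) - h 0 (r n) - h (r n) 0 + h 0 0 = (r n)\<^sup>2 * B' d c" for n
    by (rule second_difference_mean_value[of "r n" "\<lambda>s t. h t s" "\<lambda>s t. B t s" "\<lambda>s t. B' t s"])
      (use r[of n] in \<open>auto intro!: hB B\<close>)
  then obtain c d where c: "\<And>n. 0 < c n" "\<And>n. c n < r n" and d: "\<And>n. 0 < d n" "\<And>n. d n < r n"
    and cd: "\<And>n. h (r n) (r n) - h 0 (r n) - h (r n) 0 + h 0 0 = (r n)\<^sup>2 * B' (d n) (c n)" by metis
  have lim0: "x \<longlonglongrightarrow> 0" if "\<And>n. 0 < x n" "\<And>n. x n < r n" for x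
    by (rule tendsto_sandwich[OF _ _ tendsto_const r0]) (use that in \<open>simp_all add: less_imp_le\<close>)
  have "(\<lambda>n. A' (a n) (b n)) \<longlonglongrightarrow> A' 0 0"
    using isCont_tendsto_compose[OF A' tendsto_Pair[OF lim0[OF a] lim0[OF b]]] by simp
  moreover have "(\<lambda>n. B' (d n) (c n)) \<longlonglongrightarrow> B' 0 0"
    using isCont_tendsto_compose[OF B' tendsto_Pair[OF lim0[OF d] lim0[OF c]]] by simp
  moreover have "A' (a n) (b n) = B' (d n) (c n)" for n
  proof -
    have "(r n)\<^sup>2 * A' (a n) (b n) = (r n)\<^sup>2 * B' (d n) (c n)"
      unfolding ab[symmetric] cd[symmetric] by simp
    then show ?thesis using r[of n] by simp
  qed
  ultimately show ?thesis using LIMSEQ_unique by auto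
qed

section \<open>Derivatives along lines in the assignment manifold\<close>

lemma assignment_mfd_pos: "W \<in> assignment_mfd \<Longrightarrow> 0 < W $ i $ j"
  by (simp add: assignment_mfd_def simplex_mfd_def)

text \<open>Tangent directions keep all row sums equal to 1, and positivity of finitely many entries
  is an open condition. The second parameter serves the mixed derivatives.\<close>

lemma assignment_mfd_line_in:
  fixes W U V :: "real ^ 'c ^ 'n"
  assumes W: "W \<in> assignment_mfd" and U: "U \<in> assignment_tangent" and V: "V \<in> assignment_tangent"
  shows "\<exists>\<epsilon>>0. \<forall>s t. \<bar>s\<bar> < \<epsilon> \<longrightarrow> \<bar>t\<bar> < \<epsilon> \<longrightarrow> W + s *\<^sub>R U + t *\<^sub>R V \<in> assignment_mfd"
proof -
  have "\<forall>\<^sub>F p in nhds (0, 0). 0 < W $ i $ j + fst p * U $ i $ j + snd p * V $ i $ j" for i j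
  proof (rule order_tendstoD)
    show "((\<lambda>p. W $ i $ j + fst p * U $ i $ j + snd p * V $ i $ j) \<longlongrightarrow>
        W $ i $ j + fst (0 :: real, 0 :: real) * U $ i $ j + snd (0 :: real, 0 :: real) * V $ i $ j)
        (nhds (0, 0))"
      by (intro tendsto_intros filterlim_ident)
  qed (use assignment_mfd_pos[OF W] in simp)
  then have "\<forall>\<^sub>F p in nhds (0, 0). \<forall>i j. 0 < W $ i $ j + fst p * U $ i $ j + snd p * V $ i $ j"
    by (intro eventually_all_finite)
  then obtain e where e: "0 < e" "\<And>p. dist p (0, 0) < e \<Longrightarrow>
      \<forall>i j. 0 < W $ i $ j + fst p * U $ i $ j + snd p * V $ i $ j"
    unfolding eventually_nhds_metric by blast
  show ?thesis
  proof (intro exI[of _ "e / 2"] conjI allI impI)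
    show "0 < e / 2" using e by simp
    fix s t :: real
    assume "\<bar>s\<bar> < e / 2" "\<bar>t\<bar> < e / 2"
    then have "dist (s, t) (0, 0) < e"
      using norm_Pair_le[of s t] by (simp add: dist_norm)
    from e(2)[OF this] show "W + s *\<^sub>R U + t *\<^sub>R V \<in> assignment_mfd"
      using W U V by (auto simp: assignment_mfd_def simplex_mfd_def assignment_tangent_def
          simplex_tangent_def inner_add_right)
  qed
qed

lemma zero_in_assignment_tangent [simp]: "0 \<in> assignment_tangent"
  by (simp add: assignment_tangent_def simplex_tangent_def)

text \<open>Near \<tau> the line stays in the manifold, so the derivative within the manifold
  becomes an ordinary two-sided one.\<close>

lemma DERIV_along_assignment_line:
  assumes "(J has_derivative J') (at X within assignment_mfd)"
    and X: "X \<in> assignment_mfd" "X = W + \<tau> *\<^sub>R V" and V: "V \<in> assignment_tangent"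
  shows "((\<lambda>t. J (W + t *\<^sub>R V)) has_real_derivative J' V) (at \<tau>)"
proof -
  obtain \<epsilon> where \<epsilon>: "0 < \<epsilon>" "\<And>s t. \<bar>s\<bar> < \<epsilon> \<Longrightarrow> \<bar>t\<bar> < \<epsilon> \<Longrightarrow> X + s *\<^sub>R 0 + t *\<^sub>R V \<in> assignment_mfd"
    using assignment_mfd_line_in[OF X(1) zero_in_assignment_tangent V] by blast
  have img: "(\<lambda>t. W + t *\<^sub>R V) ` ball \<tau> \<epsilon> \<subseteq> assignment_mfd"
  proof clarify
    fix t assume "t \<in> ball \<tau> \<epsilon>"
    then show "W + t *\<^sub>R V \<in> assignment_mfd"
      using \<epsilon>(2)[of 0 "t - \<tau>"] \<epsilon>(1) X(2) by (simp add: dist_real_def algebra_simps)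
  qed
  have "((\<lambda>t. W + t *\<^sub>R V) has_derivative (\<lambda>t. t *\<^sub>R V)) (at \<tau> within ball \<tau> \<epsilon>)"
    by (auto intro!: derivative_eq_intros)
  then have "((\<lambda>t. J (W + t *\<^sub>R V)) has_derivative (\<lambda>t. J' (t *\<^sub>R V))) (at \<tau> within ball \<tau> \<epsilon>)"
    by (rule has_derivative_in_compose[where f="\<lambda>t. W + t *\<^sub>R V"])
      (use has_derivative_subset[OF assms(1) img] X(2) in simp)
  then have "((\<lambda>t. J (W + t *\<^sub>R V)) has_derivative (\<lambda>t. J' (t *\<^sub>R V))) (at \<tau>)"
    using \<epsilon>(1) by (simp add: at_within_open[of \<tau> "ball \<tau> \<epsilon>"])
  moreover have "J' (t *\<^sub>R V) = J' V * t" for t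
    using assms(1) by (simp add: has_derivative_def bounded_linear.linear linear_cmul)
  ultimately show ?thesis by (simp add: has_field_derivative_def)
qed

section \<open>Replicator matrices and the Riemannian gradient\<close>

lemma replicator_mult_nth: "(replicator p *v w) $ j = p $ j * (w $ j - p \<bullet> w)"
proof -
  have "(replicator p *v w) $ j = (\<Sum>k\<in>UNIV. (if j = k then p $ j * w $ k else 0) - p $ j * (p $ k * w $ k))"
    by (auto simp: replicator_def matrix_vector_mult_def algebra_simps intro!: sum.cong)
  also have "\<dots> = p $ j * (w $ j - p \<bullet> w)"
    by (simp add: sum_subtractf sum_distrib_left inner_vec_def right_diff_distrib)
  finally show ?thesis .
qed

lemma inner_one_eq_sum: "(1 :: real ^ 'c) \<bullet> v = (\<Sum>j\<in>UNIV. v $ j)"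
  by (simp add: inner_vec_def)

lemma replicator_rows_in_tangent:
  assumes "W \<in> assignment_mfd"
  shows "replicator_rows W X \<in> assignment_tangent"
proof -
  have "(\<Sum>j\<in>UNIV. W $ i $ j * (X $ i $ j - W $ i \<bullet> X $ i)) = 0" for i
    using assms
    by (simp add: right_diff_distrib sum_subtractf sum_distrib_right[symmetric] inner_vec_def
        assignment_mfd_def simplex_mfd_def)
  then show ?thesis
    by (simp add: assignment_tangent_def simplex_tangent_def inner_one_eq_sum replicator_rows_def
        replicator_mult_nth)
qed

text \<open>The factor \<open>W $ i $ j\<close> of the replicator cancels the denominator of the
  metric, and the mean \<open>W $ i \<bullet> X $ i\<close> pairs to zero with a tangent
  row.\<close>

lemma assignment_metric_replicator_rows:
  assumes W: "W \<in> assignment_mfd" and V: "V \<in> assignment_tangent"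
  shows "assignment_metric W (replicator_rows W X) V = X \<bullet> V"
proof -
  have "(\<Sum>j\<in>UNIV. (X $ i $ j - W $ i \<bullet> X $ i) * V $ i $ j) = X $ i \<bullet> V $ i" for i
    using V by (simp add: left_diff_distrib sum_subtractf sum_distrib_left[symmetric]
        inner_vec_def[of "X $ i"] assignment_tangent_def simplex_tangent_def inner_one_eq_sum)
  then show ?thesis
    using assignment_mfd_pos[OF W]
    by (simp add: assignment_metric_def fisher_rao_def replicator_rows_def replicator_mult_nth
        inner_vec_def[of X] less_imp_neq[symmetric])
qed

lemma assignment_metric_diff:
  "assignment_metric W (G - H) V = assignment_metric W G V - assignment_metric W H V"
  by (simp add: assignment_metric_def fisher_rao_def sum_subtractf left_diff_distrib diff_divide_distrib)

lemma assignment_metric_minus: "assignment_metric W (- G) V = - assignment_metric W G V"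
  using assignment_metric_diff[of W 0 G V] by (simp add: assignment_metric_def fisher_rao_def)

lemma assignment_metric_self_eq_0:
  assumes W: "W \<in> assignment_mfd" and "assignment_metric W G G = 0"
  shows "G = 0"
proof -
  have nonneg: "0 \<le> G $ i $ j * G $ i $ j / W $ i $ j" for i j
    using assignment_mfd_pos[OF W, of i j] by simp
  have "G $ i $ j * G $ i $ j / W $ i $ j = 0" for i j
    using assms(2) nonneg
    by (simp add: assignment_metric_def fisher_rao_def sum_nonneg_eq_0_iff sum_nonneg)
  then have "G $ i $ j = 0" for i j
    using assignment_mfd_pos[OF W, of i j] by (metis divide_eq_0_iff less_irrefl mult_eq_0_iff)
  then show ?thesis by (simp add: vec_eq_iff)
qed

text \<open>The description behind \<open>riemannian_grad\<close> is proper: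
  \<open>replicator_rows W\<close> maps the Euclidean gradient to a Riemannian one, and uniqueness
  follows from definiteness of the metric, since lines in the manifold determine the tangential
  derivative.\<close>

lemma riemannian_grad_metric:
  assumes W: "W \<in> assignment_mfd" and J: "(J has_derivative J') (at W within assignment_mfd)"
    and V: "V \<in> assignment_tangent"
  shows "assignment_metric W (riemannian_grad J W) V = J' V"
proof -
  have unique_deriv: "J'' V = J' V" if "(J has_derivative J'') (at W within assignment_mfd)"
    and "V \<in> assignment_tangent" for J'' V
  proof (rule DERIV_unique)
    show "((\<lambda>t. J (W + t *\<^sub>R V)) has_real_derivative J'' V) (at 0)"
      "((\<lambda>t. J (W + t *\<^sub>R V)) has_real_derivative J' V) (at 0)"
      using DERIV_along_assignment_line[OF that(1) W, of W 0 V]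
        DERIV_along_assignment_line[OF J W, of W 0 V] that(2) by simp_all
  qed
  have metric: "H \<in> assignment_tangent" "\<forall>V\<in>assignment_tangent. assignment_metric W H V = J' V"
    if H: "has_riemannian_grad J H W" for H
  proof -
    show "H \<in> assignment_tangent" using H by (simp add: has_riemannian_grad_def)
    obtain J'' where "(J has_derivative J'') (at W within assignment_mfd)"
      "\<forall>V\<in>assignment_tangent. assignment_metric W H V = J'' V"
      using H by (auto simp: has_riemannian_grad_def)
    then show "\<forall>V\<in>assignment_tangent. assignment_metric W H V = J' V"
      using unique_deriv[of J''] by auto
  qed
  \<comment> \<open>The Euclidean gradient, representing \<open>J'\<close> on the whole matrix
    space.\<close>
  define G where "G = (\<Sum>b\<in>Basis. J' b *\<^sub>R b)"
  have "G \<bullet> V = J' V" for V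
  proof -
    have "J' V = J' (\<Sum>b\<in>Basis. (V \<bullet> b) *\<^sub>R b)" by (simp add: euclidean_representation)
    also have "\<dots> = (\<Sum>b\<in>Basis. (V \<bullet> b) * J' b)"
      using J by (simp add: has_derivative_def bounded_linear.linear linear_sum linear_cmul)
    also have "\<dots> = G \<bullet> V"
      unfolding G_def inner_sum_left by (rule sum.cong) (simp_all add: inner_commute)
    finally show ?thesis ..
  qed
  then have G: "has_riemannian_grad J (replicator_rows W G) W"
    unfolding has_riemannian_grad_def using J W replicator_rows_in_tangent[OF W]
    by (intro conjI exI[of _ J'] ballI) (auto simp: assignment_metric_replicator_rows)
  have "H = replicator_rows W G" if "has_riemannian_grad J H W" for H
  proof -
    let ?G = "replicator_rows W G" 
    have "H - ?G \<in> assignment_tangent"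
      using metric(1)[OF that] metric(1)[OF G]
      by (simp add: assignment_tangent_def simplex_tangent_def inner_diff_right)
    then have "assignment_metric W (H - ?G) (H - ?G) = 0"
      using metric(2)[OF that] metric(2)[OF G] by (simp add: assignment_metric_diff)
    then show ?thesis using assignment_metric_self_eq_0[OF W, of "H - ?G"] by simp
  qed
  with G have "has_riemannian_grad J (riemannian_grad J W) W"
    unfolding riemannian_grad_def by (rule theI)
  then show ?thesis using metric(2) V by simp
qed

section \<open>Closed form of the similarity map\<close>

text \<open>Division by \<open>p\<close> turns \<open>replicator p *v w\<close> into
  \<open>w\<close> minus the constant \<open>p \<bullet> w\<close>, and normalization removes
  constants in the exponent.\<close>

lemma Exp_map_replicator_nth:
  assumes p: "p \<in> simplex_mfd"
  shows "Exp_map p (replicator p *v w) $ j = p $ j * exp (w $ j) / (\<Sum>k\<in>UNIV. p $ k * exp (w $ k))"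
proof -
  have "exp ((replicator p *v w) $ k / p $ k) = exp (w $ k) * exp (- (p \<bullet> w))" for k
  proof -
    have "p $ k \<noteq> 0" using p by (auto simp: simplex_mfd_def less_imp_neq[symmetric])
    then show ?thesis by (simp add: replicator_mult_nth flip: exp_add)
  qed
  then show ?thesis
    by (simp add: Exp_map_def inner_vec_def mult.assoc[symmetric] flip: sum_distrib_right)
qed

text \<open>As the weights sum to 1, \<open>ln (W $ i $ l)\<close> is subtracted exactly once and
  cancels the base point of \<open>Exp_map\<close>. The normalizers of the likelihoods do not depend
  on the label and drop out, leaving a normalized weighted geometric mean of the
  likelihoods.\<close>

lemma similarity_nth:
  fixes W :: "real ^ 'c ^ 'n" and D :: "'n \<Rightarrow> real ^ 'c" and E :: "('n \<times> 'n) set"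
    and \<omega> :: "'n \<Rightarrow> 'n \<Rightarrow> real" and \<rho> :: real
  assumes W: "W \<in> assignment_mfd" and \<omega>: "(\<Sum>k\<in>neighborhood E i. \<omega> i k) = 1"
  defines "y j \<equiv> \<Sum>k\<in>neighborhood E i. \<omega> i k * (ln (W $ k $ j) - D k $ j / \<rho>)"
  shows "similarity E \<omega> \<rho> D W $ i $ j = exp (y j) / (\<Sum>l\<in>UNIV. exp (y l))"
proof -
  have simplex: "W $ k \<in> simplex_mfd" for k using W by (simp add: assignment_mfd_def)
  define Z where "Z k = (\<Sum>l\<in>UNIV. W $ k $ l * exp (- D k $ l / \<rho>))" for k
  have Z: "0 < Z k" for k
    unfolding Z_def by (intro sum_pos) (auto intro!: mult_pos_pos assignment_mfd_pos[OF W])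
  have "likelihood \<rho> D k (W $ k) $ l = W $ k $ l * exp (- D k $ l / \<rho>) / Z k" for k l
    by (simp add: likelihood_def lift_map_def Exp_map_replicator_nth[OF simplex] Z_def)
  then have ln_L: "ln (likelihood \<rho> D k (W $ k) $ l / W $ i $ l) =
      ln (W $ k $ l) - D k $ l / \<rho> - ln (Z k) - ln (W $ i $ l)" for k l
    using Z[of k] assignment_mfd_pos[OF W, of k l] assignment_mfd_pos[OF W, of i l]
    by (simp add: ln_div ln_mult)
  \<comment> \<open>By linearity, averaging the tangent vectors amounts to applying the replicator
    to the averaged logarithms.\<close>
  define w :: "real ^ 'c" where
    "w = (\<Sum>k\<in>neighborhood E i. \<omega> i k *\<^sub>R (\<chi> l. ln (likelihood \<rho> D k (W $ k) $ l / W $ i $ l)))"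
  define C where "C = (\<Sum>k\<in>neighborhood E i. \<omega> i k * ln (Z k))"
  have "w $ l = (\<Sum>k\<in>neighborhood E i. \<omega> i k * (ln (W $ k $ l) - D k $ l / \<rho>)
      - \<omega> i k * ln (Z k) - \<omega> i k * ln (W $ i $ l))" for l
    unfolding w_def by (simp add: ln_L right_diff_distrib)
  then have "w $ l = y l - C - ln (W $ i $ l)" for l
    using \<omega> by (simp add: sum_subtractf y_def C_def flip: sum_distrib_right)
  then have e: "W $ i $ l * exp (w $ l) = exp (y l) * exp (- C)" for l
    using assignment_mfd_pos[OF W, of i l] by (simp add: exp_diff exp_minus divide_simps)
  have "similarity E \<omega> \<rho> D W $ i = Exp_map (W $ i) (replicator (W $ i) *v w)"
    by (simp add: similarity_def Exp_inv_def w_def linear_sum[OF matrix_vector_mul_linear]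
        matrix_vector_mult_scaleR)
  then show ?thesis
    by (simp add: Exp_map_replicator_nth[OF simplex] e flip: sum_distrib_right)
qed

text \<open>Isolates the own row of node \<open>i\<close>, which enters only through a power;
  \<open>b\<close> collects the distances and the other rows.\<close>

lemma similarity_nth_powr:
  fixes W :: "real ^ 'c ^ 'n" and D :: "'n \<Rightarrow> real ^ 'c" and E :: "('n \<times> 'n) set"
    and \<omega> :: "'n \<Rightarrow> 'n \<Rightarrow> real" and \<rho> :: real
  assumes W: "W \<in> assignment_mfd" and \<omega>: "(\<Sum>k\<in>neighborhood E i. \<omega> i k) = 1"
  defines "b j \<equiv> exp ((\<Sum>k\<in>neighborhood E i - {i}. \<omega> i k * ln (W $ k $ j))
      - (\<Sum>k\<in>neighborhood E i. \<omega> i k * (D k $ j / \<rho>)))"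
  shows "similarity E \<omega> \<rho> D W $ i $ j =
    b j * W $ i $ j powr \<omega> i i / (\<Sum>l\<in>UNIV. b l * W $ i $ l powr \<omega> i i)"
proof -
  have "exp (\<Sum>k\<in>neighborhood E i. \<omega> i k * (ln (W $ k $ l) - D k $ l / \<rho>)) =
      b l * W $ i $ l powr \<omega> i i" for l
  proof -
    have i: "i \<in> neighborhood E i" by (simp add: neighborhood_def)
    show ?thesis
      using assignment_mfd_pos[OF W, of i l]
      by (simp add: b_def right_diff_distrib sum_subtractf sum.remove[OF finite i] powr_def
          flip: exp_add)
  qed
  then show ?thesis by (simp add: similarity_nth[where \<omega>=\<omega>, OF W \<omega>])
qed

section \<open>Second derivatives of a potential\<close>

text \<open>The quotient rule is left unsimplified so that the numerators for two directions can be
  compared term by term.\<close>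

lemma DERIV_powr_quotient:
  fixes b p u v :: "'c::finite \<Rightarrow> real"
  assumes b: "\<And>j. 0 < b j" and q: "\<And>j. 0 < p j + \<tau> * v j"
  shows "((\<lambda>t. (\<Sum>j\<in>UNIV. u j * (b j * (p j + t * v j) powr w)) / (\<Sum>j\<in>UNIV. b j * (p j + t * v j) powr w))
    has_real_derivative
      ((\<Sum>j\<in>UNIV. u j * (b j * (w * (p j + \<tau> * v j) powr (w - 1) * v j))) *
          (\<Sum>j\<in>UNIV. b j * (p j + \<tau> * v j) powr w)
        - (\<Sum>j\<in>UNIV. u j * (b j * (p j + \<tau> * v j) powr w)) *
          (\<Sum>j\<in>UNIV. b j * (w * (p j + \<tau> * v j) powr (w - 1) * v j))) /
      ((\<Sum>j\<in>UNIV. b j * (p j + \<tau> * v j) powr w) * (\<Sum>j\<in>UNIV. b j * (p j + \<tau> * v j) powr w)))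
    (at \<tau>)"
proof (rule DERIV_divide)
  have powr: "((\<lambda>t. (p j + t * v j) powr w) has_real_derivative
      w * (p j + \<tau> * v j) powr (w - 1) * v j) (at \<tau>)" for j
    using q[of j] by (auto intro!: derivative_eq_intros)
  show "((\<lambda>t. \<Sum>j\<in>UNIV. u j * (b j * (p j + t * v j) powr w)) has_real_derivative
      (\<Sum>j\<in>UNIV. u j * (b j * (w * (p j + \<tau> * v j) powr (w - 1) * v j)))) (at \<tau>)"
    "((\<lambda>t. \<Sum>j\<in>UNIV. b j * (p j + t * v j) powr w) has_real_derivative
      (\<Sum>j\<in>UNIV. b j * (w * (p j + \<tau> * v j) powr (w - 1) * v j))) (at \<tau>)"
    by (intro DERIV_sum DERIV_cmult powr)+
  have "0 < (\<Sum>j\<in>UNIV. b j * (p j + \<tau> * v j) powr w)"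
    using b q by (intro sum_pos) (auto intro!: mult_pos_pos simp: less_imp_neq[symmetric])
  then show "(\<Sum>j\<in>UNIV. b j * (p j + \<tau> * v j) powr w) \<noteq> 0" by simp
qed

lemma similarity_potential_symmetry:
  fixes J :: "real ^ 'c ^ 'n \<Rightarrow> real" and D :: "'n \<Rightarrow> real ^ 'c" and u v :: "real ^ 'c"
    and E :: "('n \<times> 'n) set" and \<omega> :: "'n \<Rightarrow> 'n \<Rightarrow> real" and \<rho> :: real
  assumes \<omega>: "(\<Sum>k\<in>neighborhood E i. \<omega> i k) = 1"
    and J: "\<forall>W\<in>assignment_mfd. (J has_derivative J' W) (at W within assignment_mfd)"
    and grad: "\<forall>W\<in>assignment_mfd.
      replicator_rows W (similarity E \<omega> \<rho> D W) = - riemannian_grad J W"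
    and W: "W \<in> assignment_mfd" and u: "u \<in> simplex_tangent" and v: "v \<in> simplex_tangent"
  defines "b j \<equiv> exp ((\<Sum>k\<in>neighborhood E i - {i}. \<omega> i k * ln (W $ k $ j))
      - (\<Sum>k\<in>neighborhood E i. \<omega> i k * (D k $ j / \<rho>)))"
  shows "(\<Sum>j\<in>UNIV. u $ j * (b j * W $ i $ j powr \<omega> i i)) *
      (\<Sum>j\<in>UNIV. b j * (\<omega> i i * W $ i $ j powr (\<omega> i i - 1) * v $ j)) =
    (\<Sum>j\<in>UNIV. v $ j * (b j * W $ i $ j powr \<omega> i i)) *
      (\<Sum>j\<in>UNIV. b j * (\<omega> i i * W $ i $ j powr (\<omega> i i - 1) * u $ j))"
proof -
  \<comment> \<open>Only row \<open>i\<close> is moved, so \<open>b\<close> stays constant under the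
    perturbation.\<close>
  define U :: "real ^ 'c ^ 'n" where "U = axis i u"
  define V :: "real ^ 'c ^ 'n" where "V = axis i v"
  have UV: "U \<in> assignment_tangent" "V \<in> assignment_tangent"
    using u v by (auto simp: U_def V_def assignment_tangent_def axis_def simplex_tangent_def)
  obtain \<epsilon> where \<epsilon>: "0 < \<epsilon>"
    and mfd: "\<And>s t. \<bar>s\<bar> < \<epsilon> \<Longrightarrow> \<bar>t\<bar> < \<epsilon> \<Longrightarrow> W + s *\<^sub>R U + t *\<^sub>R V \<in> assignment_mfd"
    using assignment_mfd_line_in[OF W UV] by blast
  define w where "w = \<omega> i i"
  \<comment> \<open>\<open>N x / Z\<close> is the inner product of row \<open>i\<close> of the
    similarity map with \<open>x\<close>; \<open>M x\<close> is the derivative of \<open>Z\<close>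
    along \<open>x\<close>, and \<open>K x y\<close> that of \<open>N x\<close> along
    \<open>y\<close>.\<close>
  define Z where "Z q = (\<Sum>j\<in>UNIV. b j * q j powr w)" for q
  define N where "N x q = (\<Sum>j\<in>UNIV. x $ j * (b j * q j powr w))" for x :: "real ^ 'c" and q
  define M where "M x q = (\<Sum>j\<in>UNIV. b j * (w * q j powr (w - 1) * x $ j))" for x :: "real ^ 'c" and q
  define K where "K x y q = (\<Sum>j\<in>UNIV. x $ j * (b j * (w * q j powr (w - 1) * y $ j)))"
    for x y :: "real ^ 'c" and q
  define q where "q s t j = W $ i $ j + s * u $ j + t * v $ j" for s t j
  have q: "(W + s *\<^sub>R U + t *\<^sub>R V) $ i $ j = q s t j" for s t j
    by (simp add: q_def U_def V_def)
  have q_pos: "0 < q s t j" if "\<bar>s\<bar> < \<epsilon>" "\<bar>t\<bar> < \<epsilon>" for s t j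
    using assignment_mfd_pos[OF mfd[OF that], of i j] unfolding q .
  have b_pos: "0 < b j" for j by (simp add: b_def)
  have J'_axis: "J' (W + s *\<^sub>R U + t *\<^sub>R V) (axis i x) = - (N x (q s t) / Z (q s t))"
    if st: "\<bar>s\<bar> < \<epsilon>" "\<bar>t\<bar> < \<epsilon>" and x: "x \<in> simplex_tangent" for s t x
  proof -
    let ?W = "W + s *\<^sub>R U + t *\<^sub>R V"
    have *: "(\<Sum>k\<in>neighborhood E i - {i}. \<omega> i k * ln (?W $ k $ j)) =
        (\<Sum>k\<in>neighborhood E i - {i}. \<omega> i k * ln (W $ k $ j))" for j
      by (rule sum.cong) (auto simp: U_def V_def axis_def)
    have S: "similarity E \<omega> \<rho> D ?W $ i $ j = b j * q s t j powr w / Z (q s t)" for j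
      unfolding similarity_nth_powr[where \<omega>=\<omega>, OF mfd[OF st] \<omega>] * q b_def[symmetric] Z_def w_def ..
    have tan: "axis i x \<in> assignment_tangent"
      using x by (auto simp: assignment_tangent_def axis_def simplex_tangent_def)
    have "J' ?W (axis i x) = - assignment_metric ?W (replicator_rows ?W (similarity E \<omega> \<rho> D ?W)) (axis i x)"
      by (simp add: grad[rule_format, OF mfd[OF st]] assignment_metric_minus
          riemannian_grad_metric[OF mfd[OF st] J[rule_format, OF mfd[OF st]] tan])
    also have "\<dots> = - (similarity E \<omega> \<rho> D ?W $ i \<bullet> x)"
      by (simp add: assignment_metric_replicator_rows[OF mfd[OF st] tan] inner_axis)
    also have "\<dots> = - (N x (q s t) / Z (q s t))"
      by (simp add: inner_vec_def S N_def sum_divide_distrib mult.commute)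
    finally show ?thesis .
  qed
  define A' where "A' x y p = - ((K x y p * Z p - N x p * M y p) / (Z p * Z p))" for x y p
  have cont: "isCont (\<lambda>(s, t). A' x y (q s t)) (0, 0)" for x y
  proof -
    have "0 < Z (q 0 0)"
      unfolding Z_def q_def using b_pos assignment_mfd_pos[OF W]
      by (intro sum_pos) (auto intro!: mult_pos_pos simp: less_imp_neq[symmetric])
    moreover have "W $ i $ j \<noteq> 0" for j using assignment_mfd_pos[OF W, of i j] by simp
    ultimately show ?thesis
      unfolding split_beta A'_def K_def Z_def N_def M_def q_def
      by (intro continuous_intros) auto
  qed
  have deriv: "((\<lambda>t. - (N x (q s t) / Z (q s t))) has_real_derivative A' x v (q s t)) (at t)"
    "((\<lambda>s. - (N x (q s t) / Z (q s t))) has_real_derivative A' x u (q s t)) (at s)"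
    if st: "\<bar>s\<bar> < \<epsilon>" "\<bar>t\<bar> < \<epsilon>" for s t x
  proof -
    \<comment> \<open>Regrouped so that \<open>s\<close> becomes the parameter of the line in
      \<open>DERIV_powr_quotient\<close>.\<close>
    have q': "q s t j = (W $ i $ j + t * v $ j) + s * u $ j" for s t j by (simp add: q_def)
    show "((\<lambda>t. - (N x (q s t) / Z (q s t))) has_real_derivative A' x v (q s t)) (at t)"
      using q_pos[OF st] unfolding A'_def N_def Z_def K_def M_def q_def
      by (intro DERIV_minus DERIV_powr_quotient b_pos)
    show "((\<lambda>s. - (N x (q s t) / Z (q s t))) has_real_derivative A' x u (q s t)) (at s)"
      using q_pos[OF st] unfolding A'_def N_def Z_def K_def M_def q'
      by (intro DERIV_minus DERIV_powr_quotient b_pos)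
  qed
  have "A' u v (q 0 0) = A' v u (q 0 0)"
  proof (rule mixed_partials_eq[where h="\<lambda>s t. J (W + s *\<^sub>R U + t *\<^sub>R V)"
        and A="\<lambda>s t. - (N u (q s t) / Z (q s t))" and B="\<lambda>s t. - (N v (q s t) / Z (q s t))"
        and A'="\<lambda>s t. A' u v (q s t)" and B'="\<lambda>s t. A' v u (q s t)", OF \<epsilon>])
    fix s t :: real assume st: "\<bar>s\<bar> < \<epsilon>" "\<bar>t\<bar> < \<epsilon>"
    note dJ = DERIV_along_assignment_line[OF J[rule_format, OF mfd[OF st]] mfd[OF st]]
    show "((\<lambda>s. J (W + s *\<^sub>R U + t *\<^sub>R V)) has_real_derivative - (N u (q s t) / Z (q s t))) (at s)"
      using dJ[of "W + t *\<^sub>R V" s U] UV J'_axis[OF st u] by (simp add: U_def[symmetric] algebra_simps)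
    show "((\<lambda>t. J (W + s *\<^sub>R U + t *\<^sub>R V)) has_real_derivative - (N v (q s t) / Z (q s t))) (at t)"
      using dJ[of "W + s *\<^sub>R U" t V] UV J'_axis[OF st v] by (simp add: V_def[symmetric])
  qed (use deriv cont in auto)
  \<comment> \<open>The term \<open>K\<close> is symmetric since \<open>S\<^sub>i\<close> depends on \<open>W\<^sub>i\<close> componentwise up to normalization.\<close>
  moreover have "K u v (q 0 0) = K v u (q 0 0)"
    unfolding K_def by (rule sum.cong) auto
  moreover have "0 < Z (q 0 0)"
    unfolding Z_def using b_pos q_pos[of 0 0] \<epsilon>
    by (intro sum_pos) (auto intro!: mult_pos_pos simp: less_imp_neq[symmetric])
  ultimately have "N u (q 0 0) * M v (q 0 0) = N v (q 0 0) * M u (q 0 0)"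
    by (simp add: A'_def)
  then show ?thesis by (simp add: N_def M_def w_def q_def)
qed

section \<open>A point that violates the symmetry\<close>

text \<open>Doubling one entry of the uniform vector shifts its logarithm by \<open>ln 2\<close> at
  a single label, which keeps the exponents of \<open>b\<close> explicit.\<close>

definition bumped_point :: "'c \<Rightarrow> real ^ 'c" where
  "bumped_point l = (\<chi> j. (if j = l then 2 else 1) / (real CARD('c) + 1))"

lemma bumped_point_in_simplex: "bumped_point l \<in> simplex_mfd"
proof -
  have "(\<Sum>j\<in>UNIV. if j = l then 2 else 1 :: real) = (\<Sum>j\<in>UNIV. 1 + (if j = l then 1 else 0))"
    by (rule sum.cong) auto
  also have "\<dots> = real CARD('a) + 1" by (simp add: sum.distrib)
  finally have "(\<Sum>j\<in>UNIV. if j = l then 2 else 1 :: real) = real CARD('a) + 1" .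
  then show ?thesis
    by (simp add: simplex_mfd_def inner_one_eq_sum bumped_point_def add_nonneg_pos
        flip: sum_divide_distrib)
qed

lemma ln_bumped_point:
  "ln (bumped_point l $ j) = (if j = l then ln 2 else 0) - ln (real CARD('c) + 1)"
  for l :: "'c::finite"
  by (simp add: bumped_point_def ln_div add_nonneg_pos)

lemma sum_axis_diff:
  "(\<Sum>j\<in>UNIV. (axis a 1 - axis b 1 :: real ^ 'c) $ j * F j) = F a - F b"
proof -
  have "(axis a 1 - axis b 1 :: real ^ 'c) $ j * F j =
      (if j = a then F j else 0) - (if j = b then F j else 0)" for j
    by (auto simp: axis_def)
  then show ?thesis by (simp add: sum_subtractf)
qed

lemma axis_diff_in_simplex_tangent: "axis a 1 - axis b 1 \<in> simplex_tangent"
  using sum_axis_diff[of a b "\<lambda>_. 1"] by (simp add: simplex_tangent_def inner_one_eq_sum)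

theorem theorem3p4:
  fixes f :: "'n::finite \<Rightarrow> 'f::metric_space"
    and fstar :: "'c::finite \<Rightarrow> 'f"
    and \<rho> :: real
    and E :: "('n \<times> 'n) set"
    and \<omega> :: "'n \<Rightarrow> 'n \<Rightarrow> real"
  assumes "\<rho> > 0"
    and "sym E"
    and "\<And>i k. k \<in> neighborhood E i \<Longrightarrow> \<omega> i k > 0"
    and "\<And>i. (\<Sum>k\<in>neighborhood E i. \<omega> i k) = 1"
    and "CARD('c) \<ge> 3"
    and "\<exists>i0. distance_vec f fstar i0 \<notin> range (\<lambda>t::real. t *\<^sub>R (1 :: real ^ 'c))"
  shows "\<not> (\<exists>J :: real ^ 'c ^ 'n \<Rightarrow> real. assignment_smooth J \<and>
            (\<forall>W\<in>assignment_mfd.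
               replicator_rows W (similarity E \<omega> \<rho> (distance_vec f fstar) W) =
                 - riemannian_grad J W))"
proof
  define D where "D = distance_vec f fstar"
  assume "\<exists>J :: real ^ 'c ^ 'n \<Rightarrow> real. assignment_smooth J \<and>
            (\<forall>W\<in>assignment_mfd.
               replicator_rows W (similarity E \<omega> \<rho> (distance_vec f fstar) W) =
                 - riemannian_grad J W)"
  then obtain J :: "real ^ 'c ^ 'n \<Rightarrow> real" where "assignment_smooth J"
    and grad: "\<forall>W\<in>assignment_mfd.
      replicator_rows W (similarity E \<omega> \<rho> D W) = - riemannian_grad J W"
    unfolding D_def by blast
  \<comment> \<open>This supplies the first derivative of \<open>J\<close>; second derivatives come
    from the explicit formula for the similarity map.\<close>
  then have "assignment_Ck (Suc 0) J" unfolding assignment_smooth_def by blast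
  then obtain J' where J: "\<forall>W\<in>assignment_mfd.
      (J has_derivative J' W) (at W within assignment_mfd)" by auto
  obtain i where i: "D i \<notin> range (\<lambda>t::real. t *\<^sub>R (1 :: real ^ 'c))"
    using assms(6) unfolding D_def by blast
  have "\<exists>j1 j2. D i $ j1 \<noteq> D i $ j2"
  proof (rule ccontr)
    assume "\<not> ?thesis"
    \<comment> \<open>\<open>undefined\<close> stands for an arbitrary label, all entries being
      equal.\<close>
    then have "D i = (D i $ undefined) *\<^sub>R 1" by (simp add: vec_eq_iff)
    with i show False by blast
  qed
  then obtain j1 j2 where j12: "D i $ j1 \<noteq> D i $ j2" by blast
  define N where "N = neighborhood E i"
  have iN: "i \<in> N" by (simp add: N_def neighborhood_def)
  have pos: "0 < \<omega> i k" if "k \<in> N" for k using assms(3) that by (simp add: N_def)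
  have sum1: "(\<Sum>k\<in>N. \<omega> i k) = 1" using assms(4) by (simp add: N_def)
  define c where "c j = (\<Sum>k\<in>N. \<omega> i k * (D k $ j / \<rho>))" for j
  \<comment> \<open>\<open>exp (g l j)\<close> is the factor \<open>b j\<close> when all
    neighbouring rows are bumped at \<open>l\<close>.\<close>
  define g where "g l j = (\<Sum>k\<in>N - {i}. \<omega> i k * ln (bumped_point l $ j)) - c j" for l j
  have g_diff: "g l j1 - g l j2 =
      (\<Sum>k\<in>N - {i}. \<omega> i k) * ((if j1 = l then ln 2 else 0) - (if j2 = l then ln 2 else 0)) -
        (c j1 - c j2)" for l
    unfolding g_def ln_bumped_point sum_distrib_right[symmetric] by (simp only: algebra_simps)
  \<comment> \<open>If \<open>g l\<close> agreed at \<open>j1\<close> and \<open>j2\<close> for both \<open>l = j1\<close> and \<open>l = j2\<close>, then \<open>i\<close> would have no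
    neighbour but itself, and the distances to \<open>j1\<close> and \<open>j2\<close> would coincide.\<close>
  have "\<exists>l. g l j1 \<noteq> g l j2"
  proof (rule ccontr)
    assume "\<nexists>l. g l j1 \<noteq> g l j2"
    then have eq: "g l j1 - g l j2 = 0" for l by simp
    have "j1 \<noteq> j2" using j12 by auto
    \<comment> \<open>Moving the bump from \<open>j1\<close> to \<open>j2\<close> flips the sign on
      the left only, so both sides vanish.\<close>
    then have "(\<Sum>k\<in>N - {i}. \<omega> i k) * ln 2 = c j1 - c j2"
      "- ((\<Sum>k\<in>N - {i}. \<omega> i k) * ln 2) = c j1 - c j2"
      using eq[of j1, unfolded g_diff] eq[of j2, unfolded g_diff] by auto
    then have rest: "(\<Sum>k\<in>N - {i}. \<omega> i k) = 0" and c: "c j1 = c j2" by auto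
    have "N - {i} = {}"
      using rest pos by (metis Diff_iff finite less_irrefl sum_pos)
    then have "N = {i}" using iN by blast
    then have "\<omega> i i = 1" "c j = \<omega> i i * (D i $ j / \<rho>)" for j
      using sum1 by (simp_all add: c_def)
    with c j12 assms(1) show False by simp
  qed
  then obtain l where l: "g l j1 \<noteq> g l j2" by blast
  then have j1j2: "j1 \<noteq> j2" by auto
  have "\<exists>j3. j3 \<notin> {j1, j2}"
  proof (rule ccontr)
    assume "\<not> ?thesis"
    then have "(UNIV :: 'c set) \<subseteq> {j1, j2}" by blast
    then have "CARD('c) \<le> card {j1, j2}" by (rule card_mono[rotated]) simp
    with assms(5) j1j2 show False by simp
  qed
  then obtain j3 where j3: "j3 \<noteq> j1" "j3 \<noteq> j2" by blast
  \<comment> \<open>Row \<open>i\<close> gets equal entries at \<open>j1\<close> and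
    \<open>j2\<close> and a doubled one at \<open>j3\<close>; the bump at \<open>l\<close> in the
    other rows separates \<open>b j1\<close> from \<open>b j2\<close>.\<close>
  define W where "W = (\<chi> k. bumped_point (if k = i then j3 else l))"
  have W: "W \<in> assignment_mfd"
    by (simp add: W_def assignment_mfd_def bumped_point_in_simplex)
  have g: "(\<Sum>k\<in>neighborhood E i - {i}. \<omega> i k * ln (W $ k $ j))
      - (\<Sum>k\<in>neighborhood E i. \<omega> i k * (D k $ j / \<rho>)) = g l j" for j
    unfolding g_def c_def N_def by (auto simp: W_def intro!: sum.cong)
  define x where "x = 1 / (real CARD('c) + 1)"
  define w where "w = \<omega> i i"
  have x: "0 < x" by (simp add: x_def add_nonneg_pos)
  have w: "0 < w" using pos iN by (simp add: w_def)
  have Wi: "W $ i $ j1 = x" "W $ i $ j2 = x" "W $ i $ j3 = 2 * x"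
    using j3 by (simp_all add: W_def bumped_point_def x_def)
  define X where "X = x powr w"
  \<comment> \<open>\<open>Y\<close> is half of the power and \<open>z\<close> the reciprocal of \<open>x\<close>, so that the final identity is polynomial.\<close>
  define Y where "Y = (2 * x) powr w / 2"
  have XY: "0 < X" "0 < Y" using x by (simp_all add: X_def Y_def)
  have Y: "(2 * x) powr w = 2 * Y" by (simp add: Y_def)
  define z where "z = 1 / x"
  have z: "0 < z" using x by (simp add: z_def)
  have XY': "x powr (w - 1) = X * z" "(2 * x) powr (w - 1) = Y * z"
    using x by (simp_all add: X_def Y_def z_def powr_diff)
  define b where "b j = exp (g l j)" for j
  have b: "b j1 \<noteq> b j2" "0 < b j3" using l by (simp_all add: b_def)
  note sym = similarity_potential_symmetry[where \<omega>=\<omega> and i=i and u="axis j1 1 - axis j2 1"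
      and v="axis j1 1 - axis j3 1", OF assms(4) J grad W,
      OF axis_diff_in_simplex_tangent axis_diff_in_simplex_tangent,
      unfolded g b_def[symmetric] w_def[symmetric]]
  \<comment> \<open>Moves the entry of the direction to the front, so that
    \<open>sum_axis_diff\<close> also evaluates the sums with exponent \<open>w - 1\<close>.\<close>
  have comm: "b j * (w * q * y) = y * (b j * (w * q))" for j q y by simp
  have "(b j1 * X - b j2 * X) * (b j1 * (w * (X * z)) - b j3 * (w * (Y * z))) =
      (b j1 * X - b j3 * (2 * Y)) * (b j1 * (w * (X * z)) - b j2 * (w * (X * z)))"
    using sym unfolding comm sum_axis_diff Wi XY' Y X_def[symmetric] by (simp add: mult.commute)
  \<comment> \<open>After the common factor \<open>(b j1 - b j2) * X * w * z\<close> is taken out,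
    \<open>b j1 * X\<close> cancels. The doubled entry leaves \<open>b j3 * Y\<close> on one side
    against \<open>b j3 * (2 * Y)\<close> on the other.\<close>
  then have "(b j1 - b j2) * b j3 * (X * Y * w * z) = 0"
    by algebra
  then show False using b XY w z by simp
qed

end
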